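(* Let $\varepsilon>0$. Let $A\subseteq[N]$ be a multiset and let $B$ be a set of pairwise coprime prime powers such that, for each $b\in B$, the members of $\Sigma^*(A)$ do not run over all residue classes modulo $b$. If $\sum_{b\in B}\Lambda(b)>(1+\varepsilon)\log N$, then $|A|\le(1+\varepsilon^{-1})\max_{b\in B}b$.
   Context: $[N]=\{1,\dots,N\}$. For a multiset $A=\{a_1,\dots,a_d\}$, $\Sigma^*(A)=\{\sum_i\varepsilon_ia_i:\varepsilon_i\in\{0,1\},\sum_i\varepsilon_i>0\}$, and $|A|$ counts multiplicity. $\Lambda$ is the von Mangoldt function. *)

theory Defs
  imports Complex_Main "HOL-Library.Multiset" "HOL-Number_Theory.Number_Theory"
begin

text \<open>The list \<open>xs\<close> is an enumeration \<open>a\<^sub>1, \<dots>, a\<^sub>d\<close> of \<open>A\<close> with multiplicity;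
  the resulting set does not depend on its order (lemma \<open>subset_sums_mset\<close>).\<close>
definition subset_sums :: "nat multiset \<Rightarrow> nat set" where
  "subset_sums A = {(\<Sum>i<length xs. \<epsilon> i * xs ! i) | xs \<epsilon>.
     mset xs = A \<and> (\<forall>i<length xs. \<epsilon> i \<in> {0, 1}) \<and> (\<Sum>i<length xs. \<epsilon> i) > 0}"

lemma sum_indices_imp_subset:
  fixes \<epsilon> :: "nat \<Rightarrow> nat"
  assumes "\<forall>i<length xs. \<epsilon> i \<in> {0, 1}"
  shows "\<exists>S. S \<subseteq># mset xs \<and> sum_mset S = (\<Sum>i<length xs. \<epsilon> i * xs ! i) \<and>
    size S = (\<Sum>i<length xs. \<epsilon> i)"
  using assms
proof (induction xs rule: rev_induct)
  case Nil
  then show ?case by simp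
next
  case (snoc x xs)
  from snoc.prems have "\<forall>i<length xs. \<epsilon> i \<in> {0, 1}" by simp
  from snoc.IH[OF this] obtain S where S: "S \<subseteq># mset xs"
    "sum_mset S = (\<Sum>i<length xs. \<epsilon> i * xs ! i)" "size S = (\<Sum>i<length xs. \<epsilon> i)" by blast
  have eq: "(\<Sum>i<length xs. \<epsilon> i * (xs @ [x]) ! i) = (\<Sum>i<length xs. \<epsilon> i * xs ! i)"
    by (intro sum.cong) (auto simp: nth_append)
  from snoc.prems consider "\<epsilon> (length xs) = 0" | "\<epsilon> (length xs) = 1" by auto
  then show ?case
  proof cases
    case 1
    then show ?thesis using S eq
      by (intro exI[of _ S]) (simp add: subset_mset.le_add_same_cancel1 subset_mset.order_trans[of S "mset xs"])
  next
    case 2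
    then show ?thesis using S eq
      by (intro exI[of _ "add_mset x S"]) auto
  qed
qed

lemma subset_imp_sum_indices:
  fixes xs :: "nat list"
  assumes "S \<subseteq># mset xs"
  shows "\<exists>\<epsilon>. (\<forall>i<length xs. \<epsilon> i \<in> {0, 1}) \<and> sum_mset S = (\<Sum>i<length xs. \<epsilon> i * xs ! i) \<and>
    size S = (\<Sum>i<length xs. \<epsilon> i)"
  using assms
proof (induction xs arbitrary: S rule: rev_induct)
  case Nil
  then show ?case by simp
next
  case (snoc x xs)
  define T where "T = (if x \<in># S then S - {#x#} else S)"
  have "T \<subseteq># mset xs"
  proof (rule mset_subset_eqI)
    fix y
    from mset_subset_eq_count[OF snoc.prems, of y]
    show "count T y \<le> count (mset xs) y"
      by (auto simp: T_def not_in_iff split: if_splits)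
  qed
  from snoc.IH[OF this] obtain \<epsilon> where e: "\<forall>i<length xs. \<epsilon> i \<in> {0, 1}"
    "sum_mset T = (\<Sum>i<length xs. \<epsilon> i * xs ! i)" "size T = (\<Sum>i<length xs. \<epsilon> i)" by blast
  define \<delta> where "\<delta> = \<epsilon>(length xs := if x \<in># S then 1 else 0)"
  have d1: "(\<Sum>i<length xs. \<delta> i * (xs @ [x]) ! i) = sum_mset T"
    unfolding e(2) by (intro sum.cong) (auto simp: nth_append \<delta>_def)
  have d2: "(\<Sum>i<length xs. \<delta> i) = size T"
    unfolding e(3) by (intro sum.cong) (auto simp: \<delta>_def)
  have S: "S = (if x \<in># S then add_mset x T else T)" by (auto simp: T_def)
  have s1: "sum_mset S = sum_mset T + (if x \<in># S then x else 0)" by (subst S) simp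
  have s2: "size S = size T + (if x \<in># S then 1 else 0)" by (subst S) simp
  show ?case
    by (rule exI[of _ \<delta>])
       (use e(1) in \<open>auto simp: d1 d2 s1 s2 less_Suc_eq, auto simp: \<delta>_def\<close>)
qed

lemma subset_sums_mset:
  "subset_sums (mset xs) = {(\<Sum>i<length xs. \<epsilon> i * xs ! i) | \<epsilon>.
     (\<forall>i<length xs. \<epsilon> i \<in> {0, 1}) \<and> (\<Sum>i<length xs. \<epsilon> i) > 0}" (is "_ = ?R")
proof (intro equalityI subsetI)
  fix s assume "s \<in> subset_sums (mset xs)"
  then obtain ys \<epsilon> where y: "mset ys = mset xs" "\<forall>i<length ys. \<epsilon> i \<in> {0, 1}"
    "(\<Sum>i<length ys. \<epsilon> i) > 0" "s = (\<Sum>i<length ys. \<epsilon> i * ys ! i)"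
    unfolding subset_sums_def by blast
  from sum_indices_imp_subset[OF y(2)] y obtain S where
    "S \<subseteq># mset xs" "sum_mset S = s" "size S > 0" by metis
  with subset_imp_sum_indices[of S xs] obtain \<delta> where "\<forall>i<length xs. \<delta> i \<in> {0, 1}"
    "s = (\<Sum>i<length xs. \<delta> i * xs ! i)" "(\<Sum>i<length xs. \<delta> i) > 0" by metis
  then show "s \<in> ?R" by blast
next
  fix s assume "s \<in> ?R"
  then show "s \<in> subset_sums (mset xs)" unfolding subset_sums_def by blast
qed

lemma subset_sums_altdef: "subset_sums A = {sum_mset S | S. S \<subseteq># A \<and> S \<noteq> {#}}"
proof -
  obtain xs where A: "A = mset xs" by (metis ex_mset)
  show ?thesis
    unfolding A subset_sums_mset
  proof (intro equalityI subsetI, goal_cases)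
    case (1 s)
    then obtain \<epsilon> where e: "\<forall>i<length xs. \<epsilon> i \<in> {0, 1}"
      "s = (\<Sum>i<length xs. \<epsilon> i * xs ! i)" "(\<Sum>i<length xs. \<epsilon> i) > 0" by blast
    from sum_indices_imp_subset[OF e(1)] obtain S where
      "S \<subseteq># mset xs" "sum_mset S = s" "size S > 0" using e(2,3) by metis
    then show ?case by auto
  next
    case (2 s)
    then obtain S where S: "S \<subseteq># mset xs" "S \<noteq> {#}" "s = sum_mset S" by blast
    then have "size S > 0" by (simp add: nonempty_has_size)
    with S subset_imp_sum_indices[of S xs] obtain \<epsilon> where "\<forall>i<length xs. \<epsilon> i \<in> {0, 1}"
      "s = (\<Sum>i<length xs. \<epsilon> i * xs ! i)" "(\<Sum>i<length xs. \<epsilon> i) > 0" by metis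
    then show ?case by blast
  qed
qed

end

theory Submission imports Defs begin

text \<open>For \<open>b \<in> B\<close>, each element of \<open>A\<close> coprime to \<open>b\<close> enlarges the set of subset sums modulo \<open>b\<close>
  by at least one class until it is everything, so fewer than \<open>b\<close> elements of \<open>A\<close> are coprime to \<open>b\<close>.
  Hence all but at most \<open>max B\<close> elements of \<open>A\<close> are divisible by the prime below \<open>b\<close>.
  Double counting \<open>\<Lambda>(b)\<close> over the pairs \<open>(a, b)\<close> that are not coprime gives
  \<open>(|A| - max B) \<Sum>\<Lambda>(b) \<le> |A| log N\<close>.\<close>

text \<open>Since \<open>x\<close> is a unit modulo \<open>b\<close>, the progression
  \<open>s + k * x\<close> starting at any \<open>s\<close> in \<open>S\<close> meets every residue
  class.\<close>

lemma shift_invariant_residues_eq: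
  fixes S :: "nat set"
  assumes "S \<subseteq> {..<b}" "S \<noteq> {}" "coprime x b"
    and shift: "\<And>s. s \<in> S \<Longrightarrow> (s + x) mod b \<in> S"
  shows "S = {..<b}"
proof (rule equalityI[OF assms(1)], rule subsetI)
  fix r assume "r \<in> {..<b}"
  then have r: "r < b" by simp
  obtain s where s: "s \<in> S" using assms(2) by blast
  have multiples: "(s + k * x) mod b \<in> S" for k
  proof (induction k)
    case 0
    from s assms(1) show ?case by (auto simp: subset_iff)
  next
    case (Suc k)
    from shift[OF Suc.IH] show ?case by (simp add: mod_simps algebra_simps)
  qed
  obtain y where y: "[x * y = 1] (mod b)"
    using cong_solve_coprime_nat[OF assms(3)] by auto
  \<comment> \<open>Here \<open>y\<close> inverts \<open>x\<close>, and \<open>(b - 1) * s\<close>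
    plays the role of \<open>-s\<close> in the naturals, so \<open>k * x\<close> is congruent to
    \<open>r - s\<close>.\<close>
  define k where "k = y * (r + (b - 1) * s)"
  have "[s + (x * y) * (r + (b - 1) * s) = s + 1 * (r + (b - 1) * s)] (mod b)"
    by (intro cong_add cong_mult cong_refl y)
  moreover have "s + 1 * (r + (b - 1) * s) = r + b * s"
    using r by (cases b) auto
  ultimately have "[s + (x * y) * (r + (b - 1) * s) = r + b * s] (mod b)" by (simp only:)
  moreover have "(x * y) * (r + (b - 1) * s) = k * x" by (simp add: k_def mult_ac)
  ultimately have "[s + k * x = r + b * s] (mod b)" by (simp only:)
  then have "(s + k * x) mod b = r"
    using r by (simp add: cong_def)
  then show "r \<in> S" using multiples[of k] by simp
qed

lemma card_subset_sums_mod_ge: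
  fixes A :: "nat multiset"
  assumes "b > 0" "\<forall>a\<in>#A. coprime a b"
  shows "card ((\<lambda>T. sum_mset T mod b) ` {T. T \<subseteq># A}) \<ge> min b (size A + 1)"
  using assms(2)
proof (induction A)
  case empty
  then show ?case by simp
next
  case (add x A)
  define R where "R A = (\<lambda>T. sum_mset T mod b) ` {T. T \<subseteq># A}" for A
  have R_subset: "R A \<subseteq> {..<b}" for A using assms(1) by (auto simp: R_def)
  have fin: "finite (R A)" for A using R_subset finite_subset by blast
  have IH: "card (R A) \<ge> min b (size A + 1)" using add by (simp add: R_def)
  have mono: "R A \<subseteq> R (add_mset x A)"
    unfolding R_def by (intro image_mono Collect_mono impI) (erule subset_mset.order_trans, simp)
  have shift: "(s + x) mod b \<in> R (add_mset x A)" if "s \<in> R A" for s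
  proof -
    from that obtain T where T: "T \<subseteq># A" "s = sum_mset T mod b" by (auto simp: R_def)
    then have "(s + x) mod b = sum_mset (add_mset x T) mod b"
      by (simp add: mod_simps add.commute)
    then show ?thesis using T(1) unfolding R_def by (intro image_eqI[of _ _ "add_mset x T"]) auto
  qed
  have "card (R (add_mset x A)) \<ge> min b (size (add_mset x A) + 1)"
  proof (cases "R (add_mset x A) = R A")
    case True
    \<comment> \<open>If \<open>x\<close> contributes no new class, \<open>R A\<close> is closed
      under translation by the unit \<open>x\<close>, hence is already everything.\<close>
    have "R A \<noteq> {}" by (auto simp: R_def)
    then have "R A = {..<b}"
      using shift_invariant_residues_eq[OF R_subset] shift True add.prems by auto
    then show ?thesis using True by simp
  next
    case False
    then have "card (R A) < card (R (add_mset x A))"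
      using mono fin by (intro psubset_card_mono) auto
    then show ?thesis using IH by simp
  qed
  then show ?case by (simp add: R_def)
qed

text \<open>One coprime element \<open>x\<close> is set aside and included in every sum, which makes
  the sums nonempty. The remaining \<open>b - 1\<close> or more coprime elements, with the empty sum
  allowed, already reach all classes.\<close>

lemma subset_sums_cover_residues:
  fixes A :: "nat multiset"
  assumes "b > 0" "size {#a \<in># A. coprime a b#} \<ge> b"
  shows "\<exists>s\<in>subset_sums A. [s = r] (mod b)"
proof -
  obtain x U where U: "{#a \<in># A. coprime a b#} = add_mset x U"
    using assms by (metis multiset_cases size_empty not_le)
  have coprime_U: "\<forall>a\<in>#U. coprime a b"
    by (metis U filter_mset_eq_conv insert_iff set_mset_add_mset_insert)
  have sub: "add_mset x U \<subseteq># A" unfolding U[symmetric] by simp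
  have "size U + 1 \<ge> b" using assms(2) U by simp
  then have "card ((\<lambda>T. sum_mset T mod b) ` {T. T \<subseteq># U}) \<ge> card {..<b}"
    using card_subset_sums_mod_ge[OF assms(1) coprime_U] by simp
  moreover have "(\<lambda>T. sum_mset T mod b) ` {T. T \<subseteq># U} \<subseteq> {..<b}"
    using assms(1) by auto
  ultimately have "(\<lambda>T. sum_mset T mod b) ` {T. T \<subseteq># U} = {..<b}"
    by (intro card_seteq) auto
  \<comment> \<open>The class of \<open>r - x\<close>, written without subtraction; adding
    \<open>x\<close> back gives \<open>r\<close>.\<close>
  moreover have "(r + (b - 1) * x) mod b \<in> {..<b}" using assms(1) by simp
  ultimately obtain T where T: "T \<subseteq># U" "(r + (b - 1) * x) mod b = sum_mset T mod b"
    by (smt (verit, best) imageE mem_Collect_eq)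
  have "[x + sum_mset T = x + (r + (b - 1) * x)] (mod b)"
    using T(2) by (intro cong_add cong_refl) (simp add: cong_def)
  moreover have "x + (r + (b - 1) * x) = r + b * x" using assms(1) by (cases b) auto
  ultimately have "[x + sum_mset T = r + b * x] (mod b)" by (simp only:)
  then have "[sum_mset (add_mset x T) = r] (mod b)" by (simp add: cong_def)
  moreover have "add_mset x T \<subseteq># A"
    using T(1) sub by (meson mset_subset_eq_add_mset_cancel subset_mset.order_trans)
  then have "sum_mset (add_mset x T) \<in> subset_sums A"
    unfolding subset_sums_altdef by (intro CollectI exI[of _ "add_mset x T"]) simp
  ultimately show ?thesis by blast
qed

text \<open>Coprimality makes the primes below these \<open>b\<close> distinct, and all of them
  divide \<open>n\<close>. The sum is therefore part of the divisor sum of \<open>mangoldt\<close>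
  over \<open>n\<close>, which equals \<open>ln n\<close>.\<close>

lemma sum_mangoldt_not_coprime_le_ln:
  assumes "finite B" "\<forall>b\<in>B. primepow b" "pairwise coprime B" "n > 0"
  shows "(\<Sum>b | b \<in> B \<and> \<not> coprime n b. mangoldt b) \<le> ln (real n)"
proof -
  define C where "C = {b \<in> B. \<not> coprime n b}"
  have C: "finite C" using assms(1) by (simp add: C_def)
  have prime: "prime (aprimedivisor b)" "aprimedivisor b dvd b" if "b \<in> B" for b
    using that assms(2) primepow_gt_Suc_0[of b] prime_aprimedivisor'[of b] aprimedivisor_dvd'[of b]
    by auto
  have inj: "inj_on aprimedivisor C"
  proof (rule inj_onI, rule ccontr)
    fix b c assume bc: "b \<in> C" "c \<in> C" "aprimedivisor b = aprimedivisor c" "b \<noteq> c"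
    then have "coprime b c" using assms(3) by (auto simp: pairwise_def C_def)
    then show False using bc prime[of b] prime[of c]
      by (auto simp: C_def) (metis coprime_common_divisor not_prime_unit)
  qed
  have dvd: "aprimedivisor b dvd n" if "b \<in> C" for b
  proof -
    have b: "b \<in> B" "\<not> coprime n b" using that by (auto simp: C_def)
    obtain p k where pk: "prime p" "b = p ^ k" "k > 0"
      using assms(2) b(1) by (auto simp: primepow_def)
    then have "p dvd n"
      using b(2) by (metis coprime_commute coprime_power_left_iff prime_imp_coprime)
    then show ?thesis using pk by (simp add: aprimedivisor_prime_power)
  qed
  \<comment> \<open>Passing to the prime keeps the value of \<open>mangoldt\<close> and yields a
    divisor of \<open>n\<close>, which \<open>b\<close> itself need not be.\<close>
  have "(\<Sum>b\<in>C. mangoldt b :: real) = (\<Sum>b\<in>C. mangoldt (aprimedivisor b))"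
  proof (rule sum.cong)
    fix b assume "b \<in> C"
    then have "b \<in> B" by (simp add: C_def)
    then show "mangoldt b = (mangoldt (aprimedivisor b) :: real)"
      using assms(2) prime(1)[of b] aprimedivisor_prime_power[of "aprimedivisor b" 1]
      by (simp add: mangoldt_def)
  qed simp
  also have "\<dots> = (\<Sum>p\<in>aprimedivisor ` C. mangoldt p)"
    by (simp add: sum.reindex[OF inj])
  also have "\<dots> \<le> (\<Sum>d | d dvd n. mangoldt d)"
    using assms(4) dvd by (intro sum_mono2) (auto simp: mangoldt_nonneg)
  also have "\<dots> = ln (real n)"
    using mangoldt_sum[of n, where ?'a = real] assms(4) by simp
  finally show ?thesis by (simp add: C_def)
qed

text \<open>Double counting of non-coprime pairs: each \<open>x\<close> in \<open>A\<close> adds the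
  weights of the \<open>b\<close> not coprime to it, at most \<open>ln x\<close> in total.\<close>

lemma sum_mangoldt_times_size_le:
  assumes "finite B" "\<forall>b\<in>B. primepow b" "pairwise coprime B" "set_mset A \<subseteq> {1..N}"
  shows "(\<Sum>b\<in>B. mangoldt b * real (size {#a \<in># A. \<not> coprime a b#})) \<le> real (size A) * ln (real N)"
  using assms(4)
proof (induction A)
  case empty
  then show ?case by simp
next
  case (add x A)
  have "(\<Sum>b\<in>B. mangoldt b * real (size {#a \<in># add_mset x A. \<not> coprime a b#}))
      = (\<Sum>b\<in>B. mangoldt b * real (size {#a \<in># A. \<not> coprime a b#}))
        + (\<Sum>b\<in>B. if \<not> coprime x b then mangoldt b else 0)"
    unfolding sum.distrib[symmetric] by (intro sum.cong) (auto simp: algebra_simps)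
  also have "(\<Sum>b\<in>B. if \<not> coprime x b then mangoldt b else (0::real))
      = (\<Sum>b | b \<in> B \<and> \<not> coprime x b. mangoldt b)"
    using assms(1) by (intro sum.inter_filter[symmetric])
  also have "\<dots> \<le> ln (real x)"
    using add.prems by (intro sum_mangoldt_not_coprime_le_ln assms) auto
  also have "\<dots> \<le> ln (real N)"
    using add.prems by simp
  also have "(\<Sum>b\<in>B. mangoldt b * real (size {#a \<in># A. \<not> coprime a b#})) \<le> real (size A) * ln (real N)"
    using add by simp
  finally show ?case by (simp add: algebra_simps)
qed

theorem theorem1p6:
  fixes \<epsilon> :: real and N :: nat and A :: "nat multiset" and B :: "nat set"
  assumes "\<epsilon> > 0"
    and "N \<ge> 1"
    and "set_mset A \<subseteq> {1..N}"
    and "finite B"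
    and "\<forall>b\<in>B. primepow b"
    and "pairwise coprime B"
    and "\<forall>b\<in>B. \<not> (\<forall>r. \<exists>s\<in>subset_sums A. [s = r] (mod b))"
    and "(\<Sum>b\<in>B. mangoldt b) > (1 + \<epsilon>) * ln (real N)"
  shows "real (size A) \<le> (1 + inverse \<epsilon>) * real (Max B)"
proof (rule ccontr)
  define d where "d = real (size A)"
  define M where "M = real (Max B)"
  define L where "L = ln (real N)"
  assume "\<not> real (size A) \<le> (1 + inverse \<epsilon>) * real (Max B)"
  then have "d > (1 + inverse \<epsilon>) * M" by (simp add: d_def M_def)
  then have large: "\<epsilon> * d > (\<epsilon> + 1) * M" using assms(1) by (simp add: field_simps)
  have M: "M \<ge> 0" and L: "L \<ge> 0" using assms(2) by (auto simp: M_def L_def)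
  \<comment> \<open>This yields \<open>M < d\<close>, so that multiplying by \<open>d - M\<close>
    below preserves the strict inequality.\<close>
  have "\<epsilon> * M \<le> (\<epsilon> + 1) * M" using M by (simp add: algebra_simps)
  then have "M < d" using large assms(1) by (meson le_less_trans mult_less_cancel_left_pos)
  have few_coprime: "d - M \<le> real (size {#a \<in># A. \<not> coprime a b#})" if "b \<in> B" for b
  proof -
    have "b > 0" using that assms(5) primepow_gt_Suc_0[of b] by simp
    then have "size {#a \<in># A. coprime a b#} < b"
      using subset_sums_cover_residues[of b A] assms(7) that by (meson not_le)
    moreover have "b \<le> Max B" using that assms(4) by simp
    moreover have "size A = size {#a \<in># A. coprime a b#} + size {#a \<in># A. \<not> coprime a b#}"
      by (metis multiset_partition size_union)
    ultimately show ?thesis by (simp add: d_def M_def)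
  qed
  have "((1 + \<epsilon>) * L) * (d - M) < (\<Sum>b\<in>B. mangoldt b) * (d - M)"
    using assms(8) \<open>M < d\<close> by (simp add: L_def)
  also have "\<dots> = (\<Sum>b\<in>B. mangoldt b * (d - M))" by (simp add: sum_distrib_right)
  also have "\<dots> \<le> (\<Sum>b\<in>B. mangoldt b * real (size {#a \<in># A. \<not> coprime a b#}))"
    by (intro sum_mono mult_left_mono few_coprime mangoldt_nonneg)
  also have "\<dots> \<le> d * L"
    unfolding d_def L_def by (intro sum_mangoldt_times_size_le assms)
  \<comment> \<open>The chain gives \<open>(1 + \<epsilon>) * L * (d - M) < d * L\<close>;
    collecting terms makes the factor from \<open>large\<close> appear, which is positive while
    \<open>L \<ge> 0\<close>.\<close>
  finally have "L * (\<epsilon> * d - (\<epsilon> + 1) * M) < 0" by (simp add: algebra_simps)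
  moreover have "L * (\<epsilon> * d - (\<epsilon> + 1) * M) \<ge> 0" using L large by simp
  ultimately show False by simp
qed

end
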